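(* Let $\rho$ be a qubit state (a density operator on $\mathbb{C}^2$), and let $\mathbb{X}=\{|x\rangle\}$ and $\mathbb{Z}=\{|z\rangle\}$ be two measurement bases (orthonormal bases) of $\mathbb{C}^2$. Let $c=\max_{|x\rangle\in\mathbb{X},\,|z\rangle\in\mathbb{Z}}|\langle x|z\rangle|^2$ and let $P=\mathrm{Tr}[\rho^2]$. Then $$C^{\mathbb{X}}_{\mathrm{RE}}(\rho)+C^{\mathbb{Z}}_{\mathrm{RE}}(\rho)\ \ge\ H\left(\frac{\sqrt{2P-1}\,(2\sqrt{c}-1)+1}{2}\right)-H(\rho).$$
   Context: For a density operator $\rho$, $H(\rho)=-\mathrm{Tr}[\rho\log_2\rho]$ is the von Neumann entropy. For a real number $q\in[0,1]$, $H(q)=-q\log_2 q-(1-q)\log_2(1-q)$ is the binary Shannon entropy (with $0\log_2 0=0$). For an orthonormal basis $\mathbb{J}=\{|i\rangle\}$, the relative entropy of coherence is $C^{\mathbb{J}}_{\mathrm{RE}}(\rho)=H(\rho^{\mathrm{diag}})-H(\rho)$, where $\rho^{\mathrm{diag}}=\sum_i\langle i|\rho|i\rangle\,|i\rangle\langle i|$ is $\rho$ dephased in the basis $\mathbb{J}$. *)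

theory Defs
  imports "HOL-Analysis.Analysis"
begin

section \<open>Vectors, bases and states of \<open>\<complex>\<^sup>n\<close>\<close>

text \<open>Hermitian inner product, conjugate-linear in the first argument.  (The library's \<open>\<bullet>\<close> on
  complex vectors is only its real part.)\<close>

definition braket :: "complex^'n \<Rightarrow> complex^'n \<Rightarrow> complex" where
  "braket u v = (\<Sum>i\<in>UNIV. cnj (u $ i) * v $ i)"

definition ket_bra :: "complex^'n \<Rightarrow> complex^'n \<Rightarrow> complex^'n^'n" where
  "ket_bra u v = (\<chi> i j. u $ i * cnj (v $ j))"

text \<open>Here \<open>vec.span\<close> is the complex span.\<close>

definition orthonormal_basis :: "(complex^'n) set \<Rightarrow> bool" where
  "orthonormal_basis B \<longleftrightarrow>
     (\<forall>u\<in>B. \<forall>v\<in>B. braket u v = (if u = v then 1 else 0)) \<and> vec.span B = UNIV"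

definition hermitian_matrix :: "complex^'n^'n \<Rightarrow> bool" where
  "hermitian_matrix A \<longleftrightarrow> map_matrix cnj (transpose A) = A"

definition density_operator :: "complex^'n^'n \<Rightarrow> bool" where
  "density_operator \<rho> \<longleftrightarrow>
     hermitian_matrix \<rho> \<and> (\<forall>v. 0 \<le> Re (braket v (\<rho> *v v))) \<and> trace \<rho> = 1"

section \<open>Entropies and coherence\<close>

text \<open>Functional calculus: if \<open>A = \<Sum>\<^sub>u d(u) |u\<rangle>\<langle>u|\<close> for an orthonormal basis of
  vectors \<open>u\<close> and real \<open>d(u)\<close>, then \<open>spectral_fun f A = \<Sum>\<^sub>u f(d(u)) |u\<rangle>\<langle>u|\<close>, independently of the
  chosen decomposition (lemma \<open>spectral_fun_eq\<close> below).\<close>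

definition spectral_fun :: "(real \<Rightarrow> real) \<Rightarrow> complex^'n^'n \<Rightarrow> complex^'n^'n" where
  "spectral_fun f A = (THE L. \<exists>B d. orthonormal_basis B \<and>
     A = (\<Sum>u\<in>B. d u *\<^sub>R ket_bra u u) \<and> L = (\<Sum>u\<in>B. f (d u) *\<^sub>R ket_bra u u))"

text \<open>For singular \<open>\<rho>\<close> the logarithm on the kernel is \<open>log 2 0\<close>, a real number, which is multiplied
  by the eigenvalue \<open>0\<close> of \<open>\<rho>\<close>; this is the convention \<open>0 log 0 = 0\<close>.  The trace is real for
  Hermitian \<open>\<rho>\<close>.\<close>

definition vn_entropy :: "complex^'n^'n \<Rightarrow> real" where
  "vn_entropy \<rho> = - Re (trace (\<rho> ** spectral_fun (log 2) \<rho>))"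

definition binary_entropy :: "real \<Rightarrow> real" where
  "binary_entropy q = - q * log 2 q - (1 - q) * log 2 (1 - q)"

definition dephase :: "(complex^'n) set \<Rightarrow> complex^'n^'n \<Rightarrow> complex^'n^'n" where
  "dephase B \<rho> = (\<Sum>u\<in>B. map_matrix ((*) (braket u (\<rho> *v u))) (ket_bra u u))"

definition coherence_RE :: "(complex^'n) set \<Rightarrow> complex^'n^'n \<Rightarrow> real" where
  "coherence_RE B \<rho> = vn_entropy (dephase B \<rho>) - vn_entropy \<rho>"

section \<open>Well-definedness of the functional calculus\<close>

lemma braket_add_right: "braket u (v + w) = braket u v + braket u w"
  by (simp add: braket_def algebra_simps sum.distrib)

lemma braket_scale_right: "braket u (c *s v) = c * braket u v"
  by (simp add: braket_def algebra_simps sum_distrib_left)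

lemma braket_zero_right [simp]: "braket u 0 = 0"
  by (simp add: braket_def)

lemma braket_sum_right: "braket u (\<Sum>i\<in>S. f i) = (\<Sum>i\<in>S. braket u (f i))"
  by (induction S rule: infinite_finite_induct) (simp_all add: braket_add_right)

lemma ket_bra_mult_vec: "ket_bra u w *v v = braket w v *s u"
  by (simp add: vec_eq_iff ket_bra_def braket_def matrix_vector_mult_def sum_distrib_right
      sum_distrib_left mult_ac)

lemma scaleR_ket_bra_mult_vec: "(c *\<^sub>R ket_bra u w) *v v = (of_real c * braket w v) *s u"
proof -
  have "(c *\<^sub>R ket_bra u w) *v v = of_real c *s (ket_bra u w *v v)"
    by (simp add: vec_eq_iff matrix_vector_mult_def sum_distrib_left mult_ac
        scaleR_conv_of_real[where 'a=complex])
  then show ?thesis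
    by (simp add: ket_bra_mult_vec)
qed

lemma sum_ket_bra_mult_vec:
  "(\<Sum>u\<in>B. d u *\<^sub>R ket_bra u u) *v v = (\<Sum>u\<in>B. (of_real (d u) * braket u v) *s u)"
  by (induction B rule: infinite_finite_induct)
    (simp_all add: matrix_vector_mult_add_rdistrib scaleR_ket_bra_mult_vec)

lemma orthonormal_basis_finite:
  assumes "orthonormal_basis B"
  shows "finite B"
proof -
  have "vec.independent B"
    unfolding vec.dependent_explicit
  proof clarify
    fix t u w
    assume t: "finite t" "t \<subseteq> B" "(\<Sum>v\<in>t. u v *s v) = 0" "w \<in> t" "u w \<noteq> 0"
    have "0 = braket w (\<Sum>v\<in>t. u v *s v)"
      using t by simp
    also have "\<dots> = (\<Sum>v\<in>t. u v * braket w v)"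
      by (simp add: braket_sum_right braket_scale_right)
    also have "\<dots> = (\<Sum>v\<in>t. if w = v then u v else 0)"
      using t assms by (intro sum.cong refl) (auto simp: orthonormal_basis_def subset_iff)
    also have "\<dots> = u w"
      using t by simp
    finally show False
      using t by simp
  qed
  then show ?thesis
    by (rule vec.finiteI_independent)
qed

lemma orthonormal_basis_braket_sum:
  assumes "orthonormal_basis B" "w \<in> B"
  shows "braket w (\<Sum>u\<in>B. c u *s u) = c w"
proof -
  have "braket w (\<Sum>u\<in>B. c u *s u) = (\<Sum>u\<in>B. if w = u then c u else 0)"
    unfolding braket_sum_right braket_scale_right
    using assms by (intro sum.cong refl) (auto simp: orthonormal_basis_def)
  then show ?thesis
    using assms orthonormal_basis_finite[OF assms(1)] by simp
qed

lemma orthonormal_basis_expand: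
  assumes B: "orthonormal_basis B"
  shows "(\<Sum>u\<in>B. braket u v *s u) = v"
proof -
  have "v \<in> vec.span B"
    using B by (simp add: orthonormal_basis_def)
  then obtain c where "v = (\<Sum>u\<in>B. c u *s u)"
    using vec.span_finite[OF orthonormal_basis_finite[OF B]] by auto
  then show ?thesis
    using orthonormal_basis_braket_sum[OF B] by simp
qed

lemma matrix_eq_on_basis:
  fixes L M :: "complex^'n^'n"
  assumes B: "orthonormal_basis B" and eq: "\<And>u. u \<in> B \<Longrightarrow> L *v u = M *v u"
  shows "L = M"
proof -
  have "L *v v = M *v v" for v
  proof -
    have "v \<in> vec.span B"
      using B by (simp add: orthonormal_basis_def)
    then show ?thesis
      by (induction rule: vec.span_induct_alt)
        (simp_all add: eq matrix_vector_right_distrib vector_scalar_commute)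
  qed
  then show ?thesis
    by (simp add: matrix_eq)
qed

lemma spectral_sum_unique:
  fixes f :: "real \<Rightarrow> real"
  assumes B: "orthonormal_basis B" and C: "orthonormal_basis C"
    and eq: "(\<Sum>u\<in>B. d u *\<^sub>R ket_bra u u) = (\<Sum>u\<in>C. e u *\<^sub>R ket_bra u u)"
  shows "(\<Sum>u\<in>B. f (d u) *\<^sub>R ket_bra u u) = (\<Sum>u\<in>C. f (e u) *\<^sub>R ket_bra u u)"
proof (rule matrix_eq_on_basis[OF C])
  fix v assume v: "v \<in> C"
  have C_eval: "(\<Sum>u\<in>C. h u *\<^sub>R ket_bra u u) *v v = of_real (h v) *s v" for h
  proof -
    have "(\<Sum>u\<in>C. (of_real (h u) * braket u v) *s u) = (\<Sum>u\<in>C. if u = v then of_real (h u) *s u else 0)"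
      using C v by (intro sum.cong refl) (auto simp: orthonormal_basis_def)
    then show ?thesis
      using v orthonormal_basis_finite[OF C] by (simp add: sum_ket_bra_mult_vec)
  qed
  have coeff: "of_real (f (d u)) * braket u v = of_real (f (e v)) * braket u v" if u: "u \<in> B" for u
  proof -
    have "of_real (d u) * braket u v = braket u ((\<Sum>w\<in>B. d w *\<^sub>R ket_bra w w) *v v)"
      using u by (simp add: sum_ket_bra_mult_vec orthonormal_basis_braket_sum[OF B])
    also have "\<dots> = of_real (e v) * braket u v"
      by (simp add: eq C_eval braket_scale_right)
    finally show ?thesis
      by auto
  qed
  have "(\<Sum>u\<in>B. f (d u) *\<^sub>R ket_bra u u) *v v = (\<Sum>u\<in>B. (of_real (f (e v)) * braket u v) *s u)"
    unfolding sum_ket_bra_mult_vec by (intro sum.cong refl) (simp add: coeff)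
  also have "\<dots> = of_real (f (e v)) *s (\<Sum>u\<in>B. braket u v *s u)"
    by (simp add: vec.scale_sum_right)
  also have "\<dots> = (\<Sum>u\<in>C. f (e u) *\<^sub>R ket_bra u u) *v v"
    by (simp add: orthonormal_basis_expand[OF B] C_eval[of "\<lambda>u. f (e u)"])
  finally show "(\<Sum>u\<in>B. f (d u) *\<^sub>R ket_bra u u) *v v = (\<Sum>u\<in>C. f (e u) *\<^sub>R ket_bra u u) *v v" .
qed

lemma spectral_fun_eq:
  assumes "orthonormal_basis B" "A = (\<Sum>u\<in>B. d u *\<^sub>R ket_bra u u)"
  shows "spectral_fun f A = (\<Sum>u\<in>B. f (d u) *\<^sub>R ket_bra u u)"
  unfolding spectral_fun_def
proof (rule the_equality)
  show "\<exists>B' d'. orthonormal_basis B' \<and> A = (\<Sum>u\<in>B'. d' u *\<^sub>R ket_bra u u) \<and>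
      (\<Sum>u\<in>B. f (d u) *\<^sub>R ket_bra u u) = (\<Sum>u\<in>B'. f (d' u) *\<^sub>R ket_bra u u)"
    by (intro exI[of _ B] exI[of _ d] conjI assms refl)
next
  fix L
  assume "\<exists>B' d'. orthonormal_basis B' \<and> A = (\<Sum>u\<in>B'. d' u *\<^sub>R ket_bra u u) \<and>
      L = (\<Sum>u\<in>B'. f (d' u) *\<^sub>R ket_bra u u)"
  then obtain B' d' where B': "orthonormal_basis B'" "A = (\<Sum>u\<in>B'. d' u *\<^sub>R ket_bra u u)"
    and L: "L = (\<Sum>u\<in>B'. f (d' u) *\<^sub>R ket_bra u u)"
    by blast
  have "(\<Sum>u\<in>B'. d' u *\<^sub>R ket_bra u u) = (\<Sum>u\<in>B. d u *\<^sub>R ket_bra u u)"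
    using B'(2) assms(2) by simp
  from spectral_sum_unique[OF B'(1) assms(1) this]
  show "L = (\<Sum>u\<in>B. f (d u) *\<^sub>R ket_bra u u)"
    unfolding L .
qed

end

theory Submission
  imports Defs
begin

text \<open>Let \<open>r = sqrt (2 * P - 1)\<close>, so that \<open>\<rho>\<close> has the eigenvalues \<open>L = (1 + r) / 2\<close> and \<open>1 - L\<close>; let \<open>e\<close> be a
  unit eigenvector for \<open>L\<close>.  Pick \<open>x\<close> and \<open>z\<close> in the two bases such that their outcome
  probabilities \<open>u\<close> and \<open>v\<close> are at least \<open>1/2\<close>.  They are at most \<open>L\<close>, and
  \<open>u + v = 2 (1 - L) + r (|\<langle>x|e\<rangle>|\<^sup>2 + |\<langle>z|e\<rangle>|\<^sup>2) \<le> 1 + r sqrt c = L + q\<close>, where \<open>q\<close> is the argument of the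
  binary entropy in the bound.  Thus \<open>(L, q)\<close> weakly majorizes \<open>(u, v)\<close>.  The binary entropy \<open>H\<close> is
  concave, and decreasing on \<open>{1/2..1}\<close>, so \<open>H(u) + H(v) \<ge> H(L) + H(q)\<close>, and \<open>H(L)\<close> is the entropy
  of \<open>\<rho>\<close>.\<close>

section \<open>Concavity of the binary entropy\<close>

text \<open>The right side is the tangent of \<open>t * ln t\<close> at \<open>s\<close>; the bound
  is \<open>ln y \<le> y - 1\<close> at \<open>y = s / t\<close>.\<close>

lemma mult_log_ge_tangent:
  assumes "0 \<le> t" "0 < (s::real)"
  shows "t * ln t \<ge> t * ln s + t - s"
proof (cases "t = 0")
  case False
  with assms have t: "t > 0" by simp
  have "ln (s / t) \<le> s / t - 1"
    using t assms by (intro ln_le_minus_one) simp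
  then have "t * ln (s / t) \<le> t * (s / t - 1)"
    using t by (intro mult_left_mono) auto
  then show ?thesis
    using t assms by (simp add: ln_div algebra_simps)
qed (use assms in simp)

lemma convex_on_mult_ln: "convex_on {0..} (\<lambda>t::real. t * ln t)"
proof (rule convex_onI)
  fix w x y :: real
  assume w: "0 < w" "w < 1" and xy: "x \<in> {0..}" "y \<in> {0..}"
  define s where "s = (1 - w) * x + w * y"
  show "((1 - w) *\<^sub>R x + w *\<^sub>R y) * ln ((1 - w) *\<^sub>R x + w *\<^sub>R y)
      \<le> (1 - w) * (x * ln x) + w * (y * ln y)"
  \<comment> \<open>Both points lie above the tangent at their mean \<open>s\<close>, and averaging
    the two tangent values gives \<open>s * ln s\<close>. There is no tangent at
    \<open>s = 0\<close>, but then \<open>x = y = 0\<close>.\<close>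
  proof (cases "s > 0")
    case True
    have "(1 - w) * (x * ln s + x - s) \<le> (1 - w) * (x * ln x)"
      using w xy True by (intro mult_left_mono mult_log_ge_tangent) auto
    moreover have "w * (y * ln s + y - s) \<le> w * (y * ln y)"
      using w xy True by (intro mult_left_mono mult_log_ge_tangent) auto
    moreover have "(1 - w) * (x * ln s + x - s) + w * (y * ln s + y - s)
        = s * ln s + (s - s)"
      unfolding s_def by (simp add: algebra_simps)
    ultimately show ?thesis
      unfolding s_def by simp
  next
    case False
    have "0 \<le> (1 - w) * x" "0 \<le> w * y"
      using w xy by auto
    with False have "(1 - w) * x = 0" "w * y = 0"
      unfolding s_def by linarith+
    then have "x = 0" "y = 0"
      using w by auto
    then show ?thesis by simp
  qed
qed simp

lemma binary_entropy_minus: "binary_entropy (1 - t) = binary_entropy t"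
  by (simp add: binary_entropy_def algebra_simps)

lemma binary_entropy_concave:
  assumes "0 \<le> w" "w \<le> 1" "x \<in> {0..1}" "y \<in> {0..1}"
  shows "(1 - w) * binary_entropy x + w * binary_entropy y
    \<le> binary_entropy ((1 - w) * x + w * y)"
proof -
  define g :: "real \<Rightarrow> real" where "g t = t * ln t" for t
  have be: "binary_entropy t = - (g t + g (1 - t)) / ln 2" for t
    by (simp add: binary_entropy_def g_def log_def diff_divide_distrib)
  have "g ((1 - w) * x + w * y) \<le> (1 - w) * g x + w * g y"
    using convex_onD[OF convex_on_mult_ln, of w x y] assms by (simp add: g_def)
  moreover have "g ((1 - w) * (1 - x) + w * (1 - y)) \<le> (1 - w) * g (1 - x) + w * g (1 - y)"
    using convex_onD[OF convex_on_mult_ln, of w "1 - x" "1 - y"] assms by (simp add: g_def)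
  moreover have "(1 - w) * (1 - x) + w * (1 - y) = 1 - ((1 - w) * x + w * y)"
    by (simp add: algebra_simps)
  ultimately have "(1 - w) * (g x + g (1 - x)) + w * (g y + g (1 - y))
      \<ge> g ((1 - w) * x + w * y) + g (1 - ((1 - w) * x + w * y))"
    by (simp add: algebra_simps)
  then have "- ((1 - w) * (g x + g (1 - x)) + w * (g y + g (1 - y))) / ln 2
      \<le> - (g ((1 - w) * x + w * y) + g (1 - ((1 - w) * x + w * y))) / ln 2"
    by (intro divide_right_mono) auto
  then show ?thesis
    unfolding be by (simp only: times_divide_eq_right add_divide_distrib[symmetric] mult_minus_right
        minus_add_distrib[symmetric])
qed

text \<open>The point \<open>x\<close> lies between \<open>1 - y\<close> and \<open>y\<close>, where
  the entropy takes the same value, so concavity suffices.\<close>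

lemma binary_entropy_antimono:
  assumes "1/2 \<le> x" "x \<le> y" "y \<le> 1"
  shows "binary_entropy y \<le> binary_entropy x"
proof (cases "y = 1/2")
  case False
  define w where "w = (x - (1 - y)) / (2 * y - 1)"
  have y: "2 * y - 1 > 0"
    using assms False by simp
  have w: "0 \<le> w" "w \<le> 1"
    using assms y by (simp_all add: w_def)
  have "w * (2 * y - 1) = x - (1 - y)"
    using y by (simp add: w_def)
  then have "(1 - w) * (1 - y) + w * y = x"
    by (simp add: algebra_simps)
  then show ?thesis
    using binary_entropy_concave[OF w, of "1 - y" y] assms
    by (simp add: binary_entropy_minus algebra_simps)
next
  case True
  with assms have "x = y" by simp
  then show ?thesis by simp
qed

text \<open>Karamata's inequality for two points. If \<open>v \<le> q\<close>, monotonicity compares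
  the terms one by one. Otherwise \<open>u\<close> is raised to \<open>u'\<close>, which makes the
  sum exactly \<open>L + q\<close>; then \<open>u'\<close> and \<open>v\<close> are convex
  combinations of \<open>L\<close> and \<open>q\<close> with swapped weights.\<close>

lemma binary_entropy_sum_ge:
  assumes "1/2 \<le> u" "u \<le> L" "1/2 \<le> v" "v \<le> L" "L \<le> 1" "0 \<le> q" "q \<le> 1" "u + v \<le> L + q"
  shows "binary_entropy L + binary_entropy q \<le> binary_entropy u + binary_entropy v"
proof (cases "v \<le> q")
  case True
  then show ?thesis
    using binary_entropy_antimono[of u L] binary_entropy_antimono[of v q] assms by simp
next
  case False
  define u' where "u' = L + q - v"
  have Lq: "L - q > 0"
    using False assms by simp
  define w where "w = (v - q) / (L - q)"
  have w: "0 \<le> w" "w \<le> 1"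
    using assms Lq False by (simp_all add: w_def)
  have "w * (L - q) = v - q"
    using Lq by (simp add: w_def)
  then have v: "(1 - w) * q + w * L = v" and u': "(1 - w) * L + w * q = u'"
    by (simp_all add: algebra_simps u'_def)
  have "binary_entropy q + binary_entropy L \<le> binary_entropy v + binary_entropy u'"
    using binary_entropy_concave[OF w, of q L] binary_entropy_concave[OF w, of L q] assms
    unfolding v u' by (simp add: algebra_simps)
  moreover have "binary_entropy u' \<le> binary_entropy u"
    using assms False by (intro binary_entropy_antimono) (auto simp: u'_def)
  ultimately show ?thesis by simp
qed

section \<open>Orthonormal bases and spectral sums\<close>

lemma braket_commute: "braket v u = cnj (braket u v)"
  by (simp add: braket_def mult.commute)

lemma braket_add_left: "braket (u + v) w = braket u w + braket v w"
  by (simp add: braket_def algebra_simps sum.distrib)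

lemma braket_scale_left: "braket (c *s u) v = cnj c * braket u v"
  by (simp add: braket_def algebra_simps sum_distrib_left)

lemma of_real_cmod_square: "(complex_of_real (cmod z))\<^sup>2 = z * cnj z"
  by (metis complex_norm_square of_real_power)

lemma braket_self: "braket v v = of_real ((norm v)\<^sup>2)"
  by (simp add: braket_def norm_vec_def L2_set_def sum_nonneg of_real_cmod_square mult.commute)

lemma orthonormal_basis_norm:
  assumes "orthonormal_basis B" "u \<in> B"
  shows "norm u = 1"
proof -
  have "complex_of_real ((norm u)\<^sup>2) = 1"
    using assms by (metis braket_self orthonormal_basis_def)
  then have "(norm u)\<^sup>2 = 1"
    by (metis of_real_eq_1_iff)
  then show ?thesis
    by (simp add: power2_eq_1_iff) (metis norm_ge_zero not_one_le_zero le_minus_one_simps(3))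
qed

lemma cauchy_schwarz_braket: "cmod (braket u v) \<le> norm u * norm v"
proof -
  have "cmod (braket u v) \<le> (\<Sum>i\<in>UNIV. \<bar>norm (u $ i)\<bar> * \<bar>norm (v $ i)\<bar>)"
    unfolding braket_def by (rule order.trans[OF norm_sum]) (simp add: norm_mult)
  also have "\<dots> \<le> norm u * norm v"
    unfolding norm_vec_def by (rule L2_set_mult_ineq)
  finally show ?thesis .
qed

lemma parseval:
  assumes "orthonormal_basis B"
  shows "(\<Sum>u\<in>B. (cmod (braket u v))\<^sup>2) = (norm v)\<^sup>2"
proof -
  have "complex_of_real ((norm v)\<^sup>2) = braket v (\<Sum>u\<in>B. braket u v *s u)"
    by (simp add: orthonormal_basis_expand[OF assms] braket_self)
  also have "\<dots> = (\<Sum>u\<in>B. braket u v * cnj (braket u v))"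
    by (simp add: braket_sum_right braket_scale_right braket_commute[of v])
  also have "\<dots> = of_real (\<Sum>u\<in>B. (cmod (braket u v))\<^sup>2)"
    by (simp add: of_real_cmod_square)
  finally show ?thesis
    by (metis of_real_eq_iff)
qed

text \<open>Double counting of the squared moduli of all coordinates: each basis vector contributes
  1, and by \<open>parseval\<close> for the standard basis vectors so does each index.\<close>

lemma orthonormal_basis_card:
  fixes B :: "(complex^'n) set"
  assumes B: "orthonormal_basis B"
  shows "card B = CARD('n)"
proof -
  have "complex_of_real (\<Sum>u\<in>B. \<Sum>i\<in>UNIV. (cmod (u $ i))\<^sup>2) = (\<Sum>u\<in>B. braket u u)"
    by (simp add: braket_def of_real_cmod_square mult.commute)
  also have "\<dots> = (\<Sum>u\<in>B. 1)"
    using B by (intro sum.cong) (auto simp: orthonormal_basis_def)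
  finally have "complex_of_real (\<Sum>u\<in>B. \<Sum>i\<in>UNIV. (cmod (u $ i))\<^sup>2) = of_real (real (card B))"
    by simp
  then have "real (card B) = (\<Sum>u\<in>B. \<Sum>i\<in>UNIV. (cmod (u $ i))\<^sup>2)"
    by (metis of_real_eq_iff)
  also have "\<dots> = (\<Sum>i\<in>UNIV. \<Sum>u\<in>B. (cmod (braket u (axis i 1)))\<^sup>2)"
    by (subst sum.swap) (simp add: braket_def axis_def if_distrib cong: if_cong)
  also have "\<dots> = real CARD('n)"
    by (simp add: parseval[OF B])
  finally show ?thesis by simp
qed

section \<open>Trace, product and entropy of spectral sums\<close>

lemma spectral_sum_mult_basis:
  assumes "orthonormal_basis B" "v \<in> B"
  shows "(\<Sum>u\<in>B. d u *\<^sub>R ket_bra u u) *v v = of_real (d v) *s v"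
proof -
  have "(\<Sum>u\<in>B. (of_real (d u) * braket u v) *s u) = (\<Sum>u\<in>B. if u = v then of_real (d u) *s u else 0)"
    using assms by (intro sum.cong refl) (auto simp: orthonormal_basis_def)
  then show ?thesis
    using assms orthonormal_basis_finite[OF assms(1)] by (simp add: sum_ket_bra_mult_vec)
qed

lemma trace_spectral_sum:
  assumes "orthonormal_basis B"
  shows "trace (\<Sum>u\<in>B. d u *\<^sub>R ket_bra u u) = of_real (\<Sum>u\<in>B. d u)"
proof -
  have "trace (\<Sum>u\<in>B. d u *\<^sub>R ket_bra u u) = (\<Sum>i\<in>UNIV. \<Sum>u\<in>B. of_real (d u) * (cnj (u $ i) * u $ i))"
    by (simp add: trace_def ket_bra_def scaleR_conv_of_real[where 'a=complex] mult_ac)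
  also have "\<dots> = (\<Sum>u\<in>B. of_real (d u) * braket u u)"
    by (subst sum.swap) (simp add: braket_def sum_distrib_left)
  also have "\<dots> = (\<Sum>u\<in>B. of_real (d u))"
    using assms by (intro sum.cong) (auto simp: orthonormal_basis_def)
  finally show ?thesis by simp
qed

lemma spectral_sum_mult:
  assumes "orthonormal_basis B"
  shows "(\<Sum>u\<in>B. d u *\<^sub>R ket_bra u u) ** (\<Sum>u\<in>B. e u *\<^sub>R ket_bra u u)
    = (\<Sum>u\<in>B. (d u * e u) *\<^sub>R ket_bra u u)"
  by (rule matrix_eq_on_basis[OF assms])
    (simp add: assms spectral_sum_mult_basis matrix_vector_mul_assoc[symmetric]
      vector_scalar_commute mult.commute spectral_sum_mult_basis[where d="\<lambda>u. d u * e u"])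

lemma vn_entropy_spectral_sum:
  assumes "orthonormal_basis B"
  shows "vn_entropy (\<Sum>u\<in>B. d u *\<^sub>R ket_bra u u) = - (\<Sum>u\<in>B. d u * log 2 (d u))"
  unfolding vn_entropy_def spectral_fun_eq[OF assms refl] spectral_sum_mult[OF assms]
    trace_spectral_sum[OF assms] by simp

lemma braket_spectral_sum:
  "braket v ((\<Sum>u\<in>B. d u *\<^sub>R ket_bra u u) *v v) = of_real (\<Sum>u\<in>B. d u * (cmod (braket u v))\<^sup>2)"
  by (simp add: sum_ket_bra_mult_vec braket_sum_right braket_scale_right braket_commute[of v]
      of_real_cmod_square mult.assoc)

text \<open>The operator norm of \<open>|x\<rangle>\<langle>x| + |z\<rangle>\<langle>z|\<close> is \<open>1 + |\<langle>x|z\<rangle>|\<close>; here, Cauchy--Schwarz is applied to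
  \<open>e\<close> and its image under this operator.\<close>

lemma overlap_sum_le:
  assumes "norm e = 1" "norm x = 1" "norm z = 1"
  shows "(cmod (braket x e))\<^sup>2 + (cmod (braket z e))\<^sup>2 \<le> 1 + cmod (braket x z)"
proof -
  define \<alpha> \<beta> where "\<alpha> = braket x e" and "\<beta> = braket z e"
  define S where "S = (cmod \<alpha>)\<^sup>2 + (cmod \<beta>)\<^sup>2"
  define w where "w = \<alpha> *s x + \<beta> *s z"
  have ew: "braket e w = of_real S"
    by (simp add: w_def braket_add_right braket_scale_right braket_commute[of e] S_def
        of_real_cmod_square \<alpha>_def \<beta>_def)
  have "S \<ge> 0" by (simp add: S_def)
  have "S \<le> norm w"
    using cauchy_schwarz_braket[of e w] \<open>S \<ge> 0\<close> assms by (simp add: ew)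
  then have "S\<^sup>2 \<le> (norm w)\<^sup>2"
    using \<open>S \<ge> 0\<close> by (intro power_mono)
  also have "(norm w)\<^sup>2 = Re (braket w w)"
    by (simp add: braket_self)
  \<comment> \<open>The cross terms are kept as a number plus its conjugate, so that their sum is
    twice a real part.\<close>
  also have "braket w w = of_real S + (cnj \<alpha> * \<beta> * braket x z + cnj (cnj \<alpha> * \<beta> * braket x z))"
    using assms by (simp add: w_def braket_add_right braket_add_left braket_scale_right
        braket_scale_left S_def of_real_cmod_square braket_self[of x] braket_self[of z]
        braket_commute[of z x] algebra_simps del: complex_cnj_mult) (simp add: algebra_simps)
  also have "Re \<dots> = S + 2 * Re (cnj \<alpha> * \<beta> * braket x z)"
    by (simp del: complex_cnj_mult)
  also have "\<dots> \<le> S + 2 * (cmod \<alpha> * cmod \<beta> * cmod (braket x z))"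
    using complex_Re_le_cmod[of "cnj \<alpha> * \<beta> * braket x z"] by (simp add: norm_mult)
  also have "\<dots> \<le> S + S * cmod (braket x z)"
  proof -
    have "2 * (cmod \<alpha> * cmod \<beta>) \<le> S"
      using sum_squares_bound[of "cmod \<alpha>" "cmod \<beta>"] by (simp add: S_def)
    then have "2 * (cmod \<alpha> * cmod \<beta>) * cmod (braket x z) \<le> S * cmod (braket x z)"
      by (rule mult_right_mono) simp
    then show ?thesis by simp
  qed
  finally have le: "S * S \<le> S * (1 + cmod (braket x z))"
    by (simp add: power2_eq_square algebra_simps)
  have "S \<le> 1 + cmod (braket x z)"
  proof (cases "S = 0")
    case False
    then show ?thesis
      using le \<open>S \<ge> 0\<close> by (simp add: mult_le_cancel_left)
  qed simp
  then show ?thesis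
    by (simp add: S_def \<alpha>_def \<beta>_def)
qed

section \<open>Spectral decomposition of qubit states\<close>

text \<open>An explicit unit vector orthogonal to \<open>e\<close>, which will serve as the second
  eigenvector.\<close>

lemma orthonormal_basis_2:
  fixes e :: "complex^2"
  assumes "norm e = 1"
  defines "f \<equiv> vector [- cnj (e $ 2), cnj (e $ 1)]"
  shows "orthonormal_basis {e, f}" "e \<noteq> f"
proof -
  have ee: "cnj (e $ 1) * e $ 1 + cnj (e $ 2) * e $ 2 = 1"
    using braket_self[of e] assms by (simp add: braket_def sum_2)
  have 1: "braket e e = 1" "braket e f = 0" "braket f e = 0" "braket f f = 1"
    using ee by (simp_all add: braket_def sum_2 f_def vector_2 algebra_simps)
  then show "e \<noteq> f" by auto
  have "v = braket e v *s e + braket f v *s f" for v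
  proof -
    let ?a = "e $ 1" and ?b = "e $ 2" and ?x = "v $ 1" and ?y = "v $ 2"
    \<comment> \<open>The two coordinates of the expansion of \<open>v\<close> in \<open>e\<close>
      and \<open>f\<close>, with the squared norm of \<open>e\<close> as a common factor.\<close>
    have "(cnj ?a * ?x + cnj ?b * ?y) * ?a - (?a * ?y - ?b * ?x) * cnj ?b
        = (cnj ?a * ?a + cnj ?b * ?b) * ?x"
      and "(cnj ?a * ?x + cnj ?b * ?y) * ?b + (?a * ?y - ?b * ?x) * cnj ?a
        = (cnj ?a * ?a + cnj ?b * ?b) * ?y"
      by algebra+
    then show ?thesis
      unfolding ee by (simp add: vec_eq_iff forall_2 f_def vector_2 braket_def sum_2 algebra_simps)
  qed
  moreover have "braket e v *s e + braket f v *s f \<in> vec.span {e, f}" for v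
    by (intro vec.span_add vec.span_scale vec.span_base) auto
  ultimately have "vec.span {e, f} = UNIV"
    by (metis UNIV_eq_I)
  then show "orthonormal_basis {e, f}"
    using 1 \<open>e \<noteq> f\<close> by (simp add: orthonormal_basis_def)
qed

text \<open>Trace and purity fix the spectrum: eigenvalues \<open>L\<close> and \<open>1 - L\<close>
  satisfy \<open>L\<^sup>2 + (1 - L)\<^sup>2 = P\<close>, that is
  \<open>(2 * L - 1)\<^sup>2 = 2 * P - 1\<close>.\<close>

lemma qubit_spectral_decomposition:
  fixes \<rho> :: "complex^2^2"
  assumes \<rho>: "density_operator \<rho>"
  defines "L \<equiv> (1 + sqrt (2 * Re (trace (\<rho> ** \<rho>)) - 1)) / 2"
  obtains e f where "orthonormal_basis {e, f}" "e \<noteq> f"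
    "\<rho> = (\<Sum>u\<in>{e, f}. (if u = e then L else 1 - L) *\<^sub>R ket_bra u u)" "1/2 \<le> L" "L \<le> 1"
proof -
  define a b where "a = Re (\<rho> $ 1 $ 1)" and "b = \<rho> $ 1 $ 2"
  have herm: "cnj (\<rho> $ j $ i) = \<rho> $ i $ j" for i j
    using \<rho> by (auto simp: density_operator_def hermitian_matrix_def vec_eq_iff map_matrix_def
        transpose_def)
  have 11: "\<rho> $ 1 $ 1 = of_real a"
    using herm[of 1 1] by (simp add: a_def complex_eq_iff)
  have 21: "\<rho> $ 2 $ 1 = cnj b"
    by (simp add: b_def herm)
  have 22: "\<rho> $ 2 $ 2 = of_real (1 - a)"
    using \<rho> 11 by (simp add: density_operator_def trace_def sum_2 algebra_simps)
  have "trace (\<rho> ** \<rho>) = of_real (a\<^sup>2 + (1 - a)\<^sup>2 + 2 * (cmod b)\<^sup>2)"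
    by (simp add: trace_def sum_2 matrix_matrix_mult_def 11 21 22 b_def[symmetric]
        of_real_cmod_square) (simp add: power2_eq_square)
  then have "Re (trace (\<rho> ** \<rho>)) = a\<^sup>2 + (1 - a)\<^sup>2 + 2 * (cmod b)\<^sup>2"
    by (simp only: Re_complex_of_real)
  then have P: "2 * Re (trace (\<rho> ** \<rho>)) - 1 = (2 * a - 1)\<^sup>2 + 4 * (cmod b)\<^sup>2"
    by (simp add: power2_eq_square algebra_simps)
  have "2 * L - 1 = sqrt ((2 * a - 1)\<^sup>2 + 4 * (cmod b)\<^sup>2)"
    unfolding L_def P by (simp add: field_simps)
  then have L2: "(2 * L - 1)\<^sup>2 = (2 * a - 1)\<^sup>2 + 4 * (cmod b)\<^sup>2" and L: "1/2 \<le> L"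
    by (simp_all add: L_def P)
  \<comment> \<open>This is the characteristic equation of \<open>\<rho>\<close> at
    \<open>L\<close>.\<close>
  have "L * L - L = a * a - a + (cmod b)\<^sup>2"
    using L2 by (simp add: power2_eq_square algebra_simps)
  then have "of_real (L * L - L) = of_real (a * a - a) + b * cnj b"
    by (simp add: of_real_cmod_square)
  then have "det (\<rho> - mat (of_real L)) = 0"
    by (simp add: det_2 11 21 22 b_def[symmetric] mat_def algebra_simps)
  then obtain v where v: "(\<rho> - mat (of_real L)) *v v = 0" "v \<noteq> 0"
    by (metis invertible_det_nz invertible_left_inverse matrix_left_invertible_ker)
  define e where "e = (1 / norm v) *\<^sub>R v"
  have e1: "norm e = 1"
    using v by (simp add: e_def)
  have "e = of_real (1 / norm v) *s v"
    by (simp add: e_def vec_eq_iff scaleR_conv_of_real[where 'a=complex])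
  then have "(\<rho> - mat (of_real L)) *v e = 0"
    using v by (simp add: vector_scalar_commute)
  then have ev1: "of_real a * e $ 1 + b * e $ 2 = of_real L * e $ 1"
    and ev2: "cnj b * e $ 1 + of_real (1 - a) * e $ 2 = of_real L * e $ 2"
    by (simp_all add: vec_eq_iff forall_2 matrix_vector_mult_def sum_2 11 21 22 b_def[symmetric]
        mat_def algebra_simps)
  define f :: "complex^2" where "f = vector [- cnj (e $ 2), cnj (e $ 1)]"
  note B = orthonormal_basis_2[OF e1, folded f_def]
  have \<rho>e: "\<rho> *v e = of_real L *s e"
    using ev1 ev2 by (simp add: vec_eq_iff forall_2 matrix_vector_mult_def sum_2 11 21 22
        b_def[symmetric])
  \<comment> \<open>Conjugating the eigenvalue equations of \<open>e\<close> gives those of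
    \<open>f\<close>. This also covers the degenerate case \<open>L = 1/2\<close>.\<close>
  have \<rho>f: "\<rho> *v f = of_real (1 - L) *s f"
    using arg_cong[OF ev1, of cnj] arg_cong[OF ev2, of cnj]
    by (simp add: vec_eq_iff forall_2 matrix_vector_mult_def sum_2 11 21 22
        b_def[symmetric] f_def vector_2 algebra_simps)
  have dec: "\<rho> = (\<Sum>u\<in>{e, f}. (if u = e then L else 1 - L) *\<^sub>R ket_bra u u)"
  proof (rule matrix_eq_on_basis[OF B(1)])
    fix u assume u: "u \<in> {e, f}"
    then show "\<rho> *v u = (\<Sum>u\<in>{e, f}. (if u = e then L else 1 - L) *\<^sub>R ket_bra u u) *v u"
      unfolding spectral_sum_mult_basis[OF B(1) u, of "\<lambda>u. if u = e then L else 1 - L"]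
      using B(2) \<rho>e \<rho>f by auto
  qed
  \<comment> \<open>Positivity of \<open>\<rho>\<close> enters here: its expectation in
    \<open>f\<close> is the eigenvalue \<open>1 - L\<close>.\<close>
  have "0 \<le> Re (braket f (\<rho> *v f))"
    using \<rho> by (simp add: density_operator_def)
  also have "\<dots> = 1 - L"
    using B(1) unfolding \<rho>f braket_scale_right by (simp add: orthonormal_basis_def)
  finally show thesis
    using that[OF B dec L] by simp
qed

text \<open>The dephased state has the outcome probabilities \<open>p u\<close> as eigenvalues.
  Parseval for \<open>u\<close> in \<open>{e, f}\<close> expresses \<open>p u\<close> by the overlap
  with \<open>e\<close> alone; Parseval for \<open>e\<close> in \<open>B\<close> shows that the two
  probabilities add up to 1.\<close>

lemma vn_entropy_dephase:
  fixes B :: "(complex^2) set"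
  assumes B: "orthonormal_basis B" and x: "x \<in> B" and E: "orthonormal_basis {e, f}" "e \<noteq> f"
    and \<rho>: "\<rho> = (\<Sum>u\<in>{e, f}. (if u = e then L else 1 - L) *\<^sub>R ket_bra u u)"
  shows "vn_entropy (dephase B \<rho>) = binary_entropy (1 - L + (2 * L - 1) * (cmod (braket x e))\<^sup>2)"
proof -
  define p where "p u = 1 - L + (2 * L - 1) * (cmod (braket u e))\<^sup>2" for u
  have p: "braket u (\<rho> *v u) = of_real (p u)" if "u \<in> B" for u
  proof -
    have 1: "(cmod (braket e u))\<^sup>2 + (cmod (braket f u))\<^sup>2 = 1"
      using parseval[OF E(1), of u] E(2) orthonormal_basis_norm[OF B that] by simp
    have "braket u (\<rho> *v u) = of_real (L * (cmod (braket e u))\<^sup>2 + (1 - L) * (cmod (braket f u))\<^sup>2)"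
      unfolding \<rho> braket_spectral_sum using E(2) by simp
    also have "(cmod (braket f u))\<^sup>2 = 1 - (cmod (braket e u))\<^sup>2"
      using 1 by simp
    also have "cmod (braket e u) = cmod (braket u e)"
      by (simp add: braket_commute[of e u])
    finally show ?thesis
      by (simp add: p_def algebra_simps)
  qed
  have "dephase B \<rho> = (\<Sum>u\<in>B. p u *\<^sub>R ket_bra u u)"
    unfolding dephase_def
    by (intro sum.cong refl)
      (simp add: p vec_eq_iff map_matrix_def scaleR_conv_of_real[where 'a=complex])
  then have S: "vn_entropy (dephase B \<rho>) = - (\<Sum>u\<in>B. p u * log 2 (p u))"
    by (simp add: vn_entropy_spectral_sum[OF B])
  have "card B = 2"
    using orthonormal_basis_card[OF B] by simp
  then obtain y where y: "B = {x, y}" "x \<noteq> y"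
    using x by (auto simp: card_2_iff)
  have "norm e = 1"
    using orthonormal_basis_norm[OF E(1)] by simp
  then have y_e: "(cmod (braket y e))\<^sup>2 = 1 - (cmod (braket x e))\<^sup>2"
    using parseval[OF B, of e] y by simp
  have "p y = 1 - p x"
    unfolding p_def y_e by (simp add: algebra_simps)
  then show ?thesis
    using S y by (simp add: binary_entropy_def p_def[symmetric])
qed

text \<open>The two overlaps add up to 1. Choosing the larger one keeps the outcome probability in
  the range where the entropy decreases.\<close>

lemma ex_overlap_ge_half:
  fixes B :: "(complex^2) set"
  assumes B: "orthonormal_basis B" and "norm e = 1"
  obtains x where "x \<in> B" "1/2 \<le> (cmod (braket x e))\<^sup>2"
proof -
  have "card B = 2"
    using orthonormal_basis_card[OF B] by simp
  then obtain x y where y: "B = {x, y}" "x \<noteq> y"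
    by (auto simp: card_2_iff)
  then have "(cmod (braket x e))\<^sup>2 + (cmod (braket y e))\<^sup>2 = 1"
    using parseval[OF B, of e] assms by simp
  then show thesis
    using that[of x] that[of y] y by fastforce
qed

theorem theorem2:
  fixes \<rho> :: "complex^2^2" and X Z :: "(complex^2) set" and c P :: real
  assumes "density_operator \<rho>"
    and "orthonormal_basis X" and "orthonormal_basis Z"
    and "c = Max {(cmod (braket x z))\<^sup>2 | x z. x \<in> X \<and> z \<in> Z}"
    and "P = Re (trace (\<rho> ** \<rho>))"
  shows "coherence_RE X \<rho> + coherence_RE Z \<rho>
    \<ge> binary_entropy ((sqrt (2 * P - 1) * (2 * sqrt c - 1) + 1) / 2) - vn_entropy \<rho>"
proof -
  define L where "L = (1 + sqrt (2 * P - 1)) / 2"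
  obtain e f where E: "orthonormal_basis {e, f}" "e \<noteq> f"
    and \<rho>: "\<rho> = (\<Sum>u\<in>{e, f}. (if u = e then L else 1 - L) *\<^sub>R ket_bra u u)"
    and L: "1/2 \<le> L" "L \<le> 1"
    using qubit_spectral_decomposition[OF assms(1), folded assms(5), folded L_def] .
  have e: "norm e = 1"
    using orthonormal_basis_norm[OF E(1)] by simp
  have S: "vn_entropy \<rho> = binary_entropy L"
    unfolding \<rho> vn_entropy_spectral_sum[OF E(1)] using E(2) by (simp add: binary_entropy_def)
  obtain x where x: "x \<in> X" "1/2 \<le> (cmod (braket x e))\<^sup>2"
    using ex_overlap_ge_half[OF assms(2) e] .
  obtain z where z: "z \<in> Z" "1/2 \<le> (cmod (braket z e))\<^sup>2"
    using ex_overlap_ge_half[OF assms(3) e] .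
  have n: "norm x = 1" "norm z = 1"
    using orthonormal_basis_norm x z assms by blast+
  define C where "C = {(cmod (braket x z))\<^sup>2 | x z. x \<in> X \<and> z \<in> Z}"
  have "C = (\<lambda>(x, z). (cmod (braket x z))\<^sup>2) ` (X \<times> Z)"
    by (auto simp: C_def)
  then have C: "finite C" "(cmod (braket x z))\<^sup>2 \<in> C"
    using x z orthonormal_basis_finite[OF assms(2)] orthonormal_basis_finite[OF assms(3)]
    by auto
  have cge: "(cmod (braket x z))\<^sup>2 \<le> c"
    using C assms(4) by (simp add: C_def)
  \<comment> \<open>The maximum is attained, so Cauchy-Schwarz bounds it by 1.\<close>
  have "c \<in> C"
    using C Max_in[of C] assms(4) by (auto simp: C_def)
  then obtain x' z' where "c = (cmod (braket x' z'))\<^sup>2" "x' \<in> X" "z' \<in> Z"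
    by (auto simp: C_def)
  then have c: "0 \<le> c" "c \<le> 1"
    using cauchy_schwarz_braket[of x' z'] orthonormal_basis_norm[OF assms(2)]
      orthonormal_basis_norm[OF assms(3)]
    by (auto simp: power_le_one_iff)
  \<comment> \<open>The pair \<open>x\<close>, \<open>z\<close> was chosen by its overlaps with
    \<open>e\<close> and may fail to attain the maximum \<open>c\<close>.\<close>
  have "cmod (braket x z) \<le> sqrt c"
    using cge by (rule real_le_rsqrt)
  then have sum: "(cmod (braket x e))\<^sup>2 + (cmod (braket z e))\<^sup>2 \<le> 1 + sqrt c"
    using overlap_sum_le[OF e n] by simp
  define q where "q = (sqrt (2 * P - 1) * (2 * sqrt c - 1) + 1) / 2"
  have q: "q = 1 - L + (2 * L - 1) * sqrt c"
    by (simp add: q_def L_def field_simps)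
  \<comment> \<open>The outcome probability as a function of the overlap with \<open>e\<close>. Its
    slope is nonnegative, \<open>g (1/2) = 1/2\<close>, \<open>g 1 = L\<close> and
    \<open>g (sqrt c) = q\<close>.\<close>
  define g where "g t = 1 - L + (2 * L - 1) * t" for t
  have g_half: "1/2 \<le> g t" if "1/2 \<le> t" for t
    using mult_left_mono[OF that, of "2 * L - 1"] L by (simp add: g_def)
  have g_le: "g t \<le> L" if "t \<le> 1" for t
    using mult_left_mono[OF that, of "2 * L - 1"] L by (simp add: g_def)
  have le1: "(cmod (braket u e))\<^sup>2 \<le> 1" if "norm u = 1" for u
    using cauchy_schwarz_braket[of u e] e that by (simp add: power_le_one_iff)
  have "binary_entropy L + binary_entropy q
      \<le> binary_entropy (g ((cmod (braket x e))\<^sup>2)) + binary_entropy (g ((cmod (braket z e))\<^sup>2))"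
  proof (rule binary_entropy_sum_ge)
    show "0 \<le> q"
      using L c unfolding q by simp
    show "q \<le> 1"
      using g_le[of "sqrt c"] c L by (simp add: q g_def)
    have "(2 * L - 1) * ((cmod (braket x e))\<^sup>2 + (cmod (braket z e))\<^sup>2) \<le> (2 * L - 1) * (1 + sqrt c)"
      using sum L by (intro mult_left_mono) auto
    then show "g ((cmod (braket x e))\<^sup>2) + g ((cmod (braket z e))\<^sup>2) \<le> L + q"
      by (simp add: g_def q algebra_simps)
  qed (use x z n L g_half g_le le1 in auto)
  \<comment> \<open>Each coherence subtracts the entropy of \<open>\<rho>\<close> once; the term
    \<open>binary_entropy L\<close> cancels one of the two copies.\<close>
  then show ?thesis
    using vn_entropy_dephase[OF assms(2) x(1) E \<rho>] vn_entropy_dephase[OF assms(3) z(1) E \<rho>] S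
    by (simp add: coherence_RE_def q_def g_def)
qed

end
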